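(* Let $\mathcal{H}_1[u,\bar u]=D(u)u_{xx}+D_u(u)(u_x)^2+R(u,\bar u)$. In each of the following cases (all parameters $a_i,b_i,c_i,\delta$ real, with $a_0>0$ in (5) and $a_1>0$ in (6)), the linear space $\mathcal{W}$ of functions of $x$ is invariant under $\mathcal{H}_1$: (1) $\mathcal{W}=\mathrm{Span}\{e^{-a_0x}\}$, $D(u)=\sum_{i=0}^{n}b_iu^i$, $R(u,\bar u)=\sum_{i=1}^{n+1}c_iu^i+\delta\bar u$, $n\in\mathbb{N}$, provided $c_{k+1}=-(k+1)a_0^2b_k$ for $k=1,\dots,n$. (2) $\mathcal{W}=\mathrm{Span}\{1,e^{-a_1x}\}$, $D(u)=b_1u+b_0$, $R(u,\bar u)=-2a_1^2b_1u^2+c_1u+\delta\bar u+c_0$. (3) $\mathcal{W}=\mathrm{Span}\{1,x\}$, $R(u,\bar u)=c_1u+\delta\bar u+c_0$, and either $D(u)=b_1u+b_0$ or $D(u)=b_2u^2+b_1u+b_0$. (4) $\mathcal{W}=\mathrm{Span}\{1,x,x^2\}$, $D(u)=b_1u+b_0$, $R(u,\bar u)=c_1u+\delta\bar u+c_0$. (5) $\mathcal{W}=\mathrm{Span}\{\cos(\sqrt{a_0}\,x),\sin(\sqrt{a_0}\,x)\}$, $D(u)=b_2u^2+b_0$, $R(u,\bar u)=3a_0b_2u^3+c_1u+\delta\bar u$. (6) $\mathcal{W}=\mathrm{Span}\{1,\cos(\sqrt{a_1}\,x),\sin(\sqrt{a_1}\,x)\}$, $D(u)=b_1u+b_0$,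 $R(u,\bar u)=2a_1b_1u^2+c_1u+\delta\bar u+c_0$.
   Context: $\mathcal{H}_1$ is the right-hand side of the delayed reaction-diffusion equation $\frac{\partial^\alpha u}{\partial t^\alpha}=[D(u)u_x]_x+R(u,\bar u)$, with $\bar u=u(x,t-\tau)$. In the claim $u$ and $\bar u$ are regarded as two independent elements of $\mathcal{W}$; subscript $x$ denotes differentiation in $x$ and $D_u$ is the derivative of $D$ with respect to $u$. The space $\mathcal{W}$ is invariant under $\mathcal{H}_1$ if $\mathcal{H}_1[u,\bar u]\in\mathcal{W}$ for all $u,\bar u\in\mathcal{W}$. *)

theory Defs
  imports "HOL-Analysis.Analysis" "HOL-Library.Function_Algebras"
begin

definition fun_scale :: "real \<Rightarrow> (real \<Rightarrow> real) \<Rightarrow> real \<Rightarrow> real"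
  where "fun_scale c f = (\<lambda>x. c * f x)"

text \<open>Function types are not an instance of the class \<^class>\<open>real_vector\<close>, so the linear span
  of functions is obtained by interpreting the vector space locale.\<close>

global_interpretation fun_space: vector_space fun_scale
  by unfold_locales (auto simp: fun_scale_def fun_eq_iff algebra_simps)

definition H1 ::
  "(real \<Rightarrow> real) \<Rightarrow> (real \<Rightarrow> real \<Rightarrow> real) \<Rightarrow> (real \<Rightarrow> real) \<Rightarrow> (real \<Rightarrow> real) \<Rightarrow> real \<Rightarrow> real"
  where "H1 D R u ubar =
    (\<lambda>x. D (u x) * deriv (deriv u) x + deriv D (u x) * (deriv u x)\<^sup>2 + R (u x) (ubar x))"

text \<open>The function and its delayed copy range independently over \<open>W\<close>.\<close>

definition invariant_under ::
  "(real \<Rightarrow> real) set \<Rightarrow> ((real \<Rightarrow> real) \<Rightarrow> (real \<Rightarrow> real) \<Rightarrow> (real \<Rightarrow> real)) \<Rightarrow> bool"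
  where "invariant_under W H \<longleftrightarrow> (\<forall>u\<in>W. \<forall>ubar\<in>W. H u ubar \<in> W)"

end

(* In every case u satisfies a first-order identity that makes the top-degree part of
   (D(u) u_x)_x cancel against R: (1) u_x = -a_0 u; (2) (u_x + a_1 u) is constant;
   (5), (6) the energy a v^2 + v_x^2 is constant for v = B cos + C sin, with a the squared
   frequency. In (3) and (4) the polynomial degree does not increase. *)

theory Submission
  imports Defs
begin

lemma mem_span_singleton_fun_iff:
  "h \<in> fun_space.span {f} \<longleftrightarrow> (\<exists>A. h = (\<lambda>x. A * f x))"
  by (auto simp: fun_space.span_singleton fun_scale_def)

text \<open>\<open>fun_space.span_insert\<close> speaks of the difference
  \<open>h - fun_scale A f\<close>; the pointwise form lets generators be peeled off one at a
  time.\<close>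

lemma mem_span_insert_fun_iff:
  "h \<in> fun_space.span (insert f S) \<longleftrightarrow> (\<exists>A. \<exists>g\<in>fun_space.span S. h = (\<lambda>x. A * f x + g x))"
proof
  assume "h \<in> fun_space.span (insert f S)"
  then obtain A where "h - fun_scale A f \<in> fun_space.span S"
    by (auto simp: fun_space.span_insert)
  moreover have "h = (\<lambda>x. A * f x + (h - fun_scale A f) x)"
    by (simp add: fun_scale_def)
  ultimately show "\<exists>A. \<exists>g\<in>fun_space.span S. h = (\<lambda>x. A * f x + g x)"
    by blast
next
  assume "\<exists>A. \<exists>g\<in>fun_space.span S. h = (\<lambda>x. A * f x + g x)"
  then obtain A g where g: "g \<in> fun_space.span S" and h: "h = (\<lambda>x. A * f x + g x)"
    by blast
  have "h - fun_scale A f = g"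
    by (auto simp: h fun_scale_def)
  with g show "h \<in> fun_space.span (insert f S)"
    by (auto simp: fun_space.span_insert)
qed

lemma mem_span_pair_fun_iff:
  "h \<in> fun_space.span {f, g} \<longleftrightarrow> (\<exists>A B. h = (\<lambda>x. A * f x + B * g x))"
  unfolding mem_span_insert_fun_iff[of h f] Bex_def mem_span_singleton_fun_iff by blast

lemma mem_span_triple_fun_iff:
  "h \<in> fun_space.span {f, g, k} \<longleftrightarrow> (\<exists>A B C. h = (\<lambda>x. A * f x + B * g x + C * k x))"
  unfolding mem_span_insert_fun_iff[of h f] Bex_def mem_span_pair_fun_iff add.assoc by blast

text \<open>Invariance becomes a search for the coefficients of the image, which may depend on those
  of both arguments. The next two lemmas do the same for more generators.\<close>

lemma invariant_under_span_singletonI: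
  assumes "\<And>A A'. \<exists>P. H (\<lambda>x. A * f x) (\<lambda>x. A' * f x) = (\<lambda>x. P * f x)"
  shows "invariant_under (fun_space.span {f}) H"
  unfolding invariant_under_def Ball_def mem_span_singleton_fun_iff
  by clarify (rule assms)

lemma invariant_under_span_pairI:
  assumes "\<And>A B A' B'. \<exists>P Q. H (\<lambda>x. A * f x + B * g x) (\<lambda>x. A' * f x + B' * g x)
    = (\<lambda>x. P * f x + Q * g x)"
  shows "invariant_under (fun_space.span {f, g}) H"
  unfolding invariant_under_def Ball_def mem_span_pair_fun_iff
  by clarify (rule assms)

lemma invariant_under_span_tripleI:
  assumes "\<And>A B C A' B' C'. \<exists>P Q S.
    H (\<lambda>x. A * f x + B * g x + C * k x) (\<lambda>x. A' * f x + B' * g x + C' * k x)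
    = (\<lambda>x. P * f x + Q * g x + S * k x)"
  shows "invariant_under (fun_space.span {f, g, k}) H"
  unfolding invariant_under_def Ball_def mem_span_triple_fun_iff
  by clarify (rule assms)

text \<open>Explicit derivatives replace every \<open>deriv\<close>, so that what remains of each
  case is an algebraic identity.\<close>

lemma H1_eq:
  assumes "\<And>x. (u has_real_derivative u' x) (at x)"
    and "\<And>x. (u' has_real_derivative u'' x) (at x)"
    and "\<And>v. (D has_real_derivative D' v) (at v)"
  shows "H1 D R u ubar = (\<lambda>x. D (u x) * u'' x + D' (u x) * (u' x)\<^sup>2 + R (u x) (ubar x))"
proof -
  have "deriv u = u'" "deriv u' = u''" "deriv D = D'"
    using assms[THEN DERIV_imp_deriv] by (auto simp: fun_eq_iff)
  then show ?thesis
    by (simp add: H1_def)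
qed

text \<open>For u' = -a u and u'' = a^2 u, the monomial b_i u^i of D contributes a^2 b_i u^(i+1)
  through D u'' and i times as much through D' u'^2. The reaction coefficient of index i + 1 cancels
  this total for i >= 1; only the linear terms survive.\<close>

lemma diffusion_exp_cancels_reaction:
  fixes b c :: "nat \<Rightarrow> real"
  assumes "\<forall>k\<in>{1..n}. c (k + 1) = - (real (k + 1) * a\<^sup>2 * b k)"
  shows "(\<Sum>i=0..n. b i * v ^ i) * (a\<^sup>2 * v) + (\<Sum>i=0..n. b i * (real i * v ^ (i - 1))) * (a * v)\<^sup>2
    + (\<Sum>i=1..n + 1. c i * v ^ i) = (a\<^sup>2 * b 0 + c 1) * v"
proof -
  \<comment> \<open>At \<open>i = 0\<close> the truncated exponent \<open>i - 1\<close> is 0, but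
    the factor \<open>real i\<close> makes both sides vanish.\<close>
  have pow: "real i * v ^ (i - 1) * v\<^sup>2 = real i * v ^ (i + 1)" for i
    by (cases i) (auto simp: power2_eq_square)
  have "(\<Sum>i=0..n. b i * v ^ i) * (a\<^sup>2 * v) + (\<Sum>i=0..n. b i * (real i * v ^ (i - 1))) * (a * v)\<^sup>2
      = (\<Sum>i=0..n. a\<^sup>2 * b i * v ^ (i + 1) + a\<^sup>2 * b i * (real i * v ^ (i - 1) * v\<^sup>2))"
    by (simp add: sum_distrib_left sum_distrib_right sum.distrib power_mult_distrib mult_ac)
  also have "\<dots> = (\<Sum>i=0..n. real (i + 1) * a\<^sup>2 * b i * v ^ (i + 1))"
    unfolding pow by (simp add: algebra_simps)
  also have "\<dots> = a\<^sup>2 * b 0 * v + (\<Sum>i=1..n. real (i + 1) * a\<^sup>2 * b i * v ^ (i + 1))"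
    by (simp add: sum.atLeast_Suc_atMost)
  also have "(\<Sum>i=1..n. real (i + 1) * a\<^sup>2 * b i * v ^ (i + 1)) = - (\<Sum>i=1..n. c (i + 1) * v ^ (i + 1))"
    unfolding sum_negf[symmetric] using assms by (intro sum.cong) auto
  \<comment> \<open>The reaction sum is split at its lowest term and the rest is shifted; the linear
    term \<open>c 1 * v\<close> has no partner to cancel.\<close>
  also have "(\<Sum>i=1..n. c (i + 1) * v ^ (i + 1)) = (\<Sum>i=1..n + 1. c i * v ^ i) - c 1 * v"
    by (simp add: sum.atLeast_Suc_atMost sum.shift_bounds_cl_Suc_ivl del: sum.cl_ivl_Suc)
  finally show ?thesis
    by (simp add: algebra_simps)
qed

lemma invariant_exp:
  fixes b c :: "nat \<Rightarrow> real"
  assumes "\<forall>k\<in>{1..n}. c (k + 1) = - (real (k + 1) * a\<^sup>2 * b k)"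
  shows "invariant_under (fun_space.span {\<lambda>x. exp (- a * x)})
    (H1 (\<lambda>v. \<Sum>i=0..n. b i * v ^ i) (\<lambda>v vbar. (\<Sum>i=1..n + 1. c i * v ^ i) + \<delta> * vbar))"
proof (rule invariant_under_span_singletonI, goal_cases)
  case (1 A A')
  \<comment> \<open>Naming u lets both derivatives be written as multiples of u itself, the form
    that the cancellation identity expects.\<close>
  define u where "u x = A * exp (- a * x)" for x
  have "H1 (\<lambda>v. \<Sum>i=0..n. b i * v ^ i) (\<lambda>v vbar. (\<Sum>i=1..n + 1. c i * v ^ i) + \<delta> * vbar)
      u (\<lambda>x. A' * exp (- a * x))
    = (\<lambda>x. (\<Sum>i=0..n. b i * u x ^ i) * (a\<^sup>2 * u x)
      + (\<Sum>i=0..n. b i * (real i * u x ^ (i - 1))) * (- (a * u x))\<^sup>2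
      + ((\<Sum>i=1..n + 1. c i * u x ^ i) + \<delta> * (A' * exp (- a * x))))"
    by (rule H1_eq)
      (auto simp: u_def power2_eq_square algebra_simps intro!: derivative_eq_intros sum.cong)
  also have "\<dots> = (\<lambda>x. ((a\<^sup>2 * b 0 + c 1) * A + \<delta> * A') * exp (- a * x))"
  proof
    fix x
    show "(\<Sum>i=0..n. b i * u x ^ i) * (a\<^sup>2 * u x)
      + (\<Sum>i=0..n. b i * (real i * u x ^ (i - 1))) * (- (a * u x))\<^sup>2
      + ((\<Sum>i=1..n + 1. c i * u x ^ i) + \<delta> * (A' * exp (- a * x)))
      = ((a\<^sup>2 * b 0 + c 1) * A + \<delta> * A') * exp (- a * x)"
      \<comment> \<open>The sign of u' disappears in the square; the sum up to \<open>n + 1\<close>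
        stays unsplit so that it matches the identity.\<close>
      using diffusion_exp_cancels_reaction[OF assms, of "u x"]
      unfolding power2_minus by (simp add: u_def algebra_simps del: sum.cl_ivl_Suc)
  qed
  finally show ?case
    unfolding u_def by blast
qed

lemma invariant_const_exp:
  "invariant_under (fun_space.span {\<lambda>x. 1, \<lambda>x. exp (- a * x)})
    (H1 (\<lambda>v. b1 * v + b0) (\<lambda>v vbar. - 2 * a\<^sup>2 * b1 * v\<^sup>2 + c1 * v + \<delta> * vbar + c0))"
proof (rule invariant_under_span_pairI, goal_cases)
  case (1 A B A' B')
  show ?case
    \<comment> \<open>Coefficients of 1 and exp(-a x). In exp(-2 a x), D u'' and D' u'^2 each give
      a^2 b1 B^2, and the reaction gives -2 a^2 b1 B^2.\<close>
    apply (rule exI[of _ "- 2 * a\<^sup>2 * b1 * A\<^sup>2 + c1 * A + \<delta> * A' + c0"])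
    apply (rule exI[of _ "(b1 * A + b0) * a\<^sup>2 * B - 4 * a\<^sup>2 * b1 * A * B + c1 * B + \<delta> * B'"])
    apply (subst H1_eq[where u' = "\<lambda>x. - a * B * exp (- a * x)"
          and u'' = "\<lambda>x. a\<^sup>2 * B * exp (- a * x)" and D' = "\<lambda>v. b1"])
    apply (auto simp: fun_eq_iff power2_eq_square algebra_simps intro!: derivative_eq_intros)
    done
qed

text \<open>Here u'' = 0 and u' is constant, so diffusion leaves only D' u'^2, which is affine
  because D' is. The case \<open>b2 = 0\<close> covers a D of degree one.\<close>

lemma invariant_affine:
  "invariant_under (fun_space.span {\<lambda>x. 1, \<lambda>x. x})
    (H1 (\<lambda>v. b2 * v\<^sup>2 + b1 * v + b0) (\<lambda>v vbar. c1 * v + \<delta> * vbar + c0))"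
proof (rule invariant_under_span_pairI, goal_cases)
  case (1 A B A' B')
  show ?case
    apply (rule exI[of _ "(2 * b2 * A + b1) * B\<^sup>2 + c1 * A + \<delta> * A' + c0"])
    apply (rule exI[of _ "2 * b2 * B * B\<^sup>2 + c1 * B + \<delta> * B'"])
    apply (subst H1_eq[where u' = "\<lambda>x. B" and u'' = "\<lambda>x. 0" and D' = "\<lambda>v. 2 * b2 * v + b1"])
    apply (auto simp: fun_eq_iff algebra_simps intro!: derivative_eq_intros)
    done
qed

text \<open>Both u'' and D' are constant, so D u'' and D' u'^2 have degree at most two in x.\<close>

lemma invariant_quadratic:
  "invariant_under (fun_space.span {\<lambda>x. 1, \<lambda>x. x, \<lambda>x. x\<^sup>2})
    (H1 (\<lambda>v. b1 * v + b0) (\<lambda>v vbar. c1 * v + \<delta> * vbar + c0))"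
proof (rule invariant_under_span_tripleI, goal_cases)
  case (1 A B C A' B' C')
  show ?case
    apply (rule exI[of _ "(b1 * A + b0) * 2 * C + b1 * B\<^sup>2 + c1 * A + \<delta> * A' + c0"])
    \<comment> \<open>Both factors 6 are 2 + 4: 2 from D u'' and 4 from u'^2.\<close>
    apply (rule exI[of _ "6 * b1 * B * C + c1 * B + \<delta> * B'"])
    apply (rule exI[of _ "6 * b1 * C\<^sup>2 + c1 * C + \<delta> * C'"])
    apply (subst H1_eq[where u' = "\<lambda>x. B + 2 * C * x" and u'' = "\<lambda>x. 2 * C" and D' = "\<lambda>v. b1"])
    apply (auto simp: fun_eq_iff power2_eq_square algebra_simps intro!: derivative_eq_intros)
    done
qed

text \<open>Conservation of energy, solved for the squared derivative: rewriting with it turns u'^2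
  into a polynomial in the oscillating part of u.\<close>

lemma trig_energy:
  fixes B C w t :: real
  shows "(w * (C * cos t - B * sin t))\<^sup>2 = w\<^sup>2 * (B\<^sup>2 + C\<^sup>2 - (B * cos t + C * sin t)\<^sup>2)"
proof -
  have "(C * cos t - B * sin t)\<^sup>2 + (B * cos t + C * sin t)\<^sup>2
      = (B\<^sup>2 + C\<^sup>2) * ((sin t)\<^sup>2 + (cos t)\<^sup>2)"
    by algebra
  then have "(C * cos t - B * sin t)\<^sup>2 = B\<^sup>2 + C\<^sup>2 - (B * cos t + C * sin t)\<^sup>2"
    by (simp only: sin_cos_squared_add) simp
  then show ?thesis
    by (simp add: power_mult_distrib)
qed

text \<open>The frequency \<open>w\<close> is the parameter, so square roots enter only when the
  theorem is assembled.\<close>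

lemma invariant_trig:
  "invariant_under (fun_space.span {\<lambda>x. cos (w * x), \<lambda>x. sin (w * x)})
    (H1 (\<lambda>v. b2 * v\<^sup>2 + b0) (\<lambda>v vbar. 3 * w\<^sup>2 * b2 * v ^ 3 + c1 * v + \<delta> * vbar))"
proof (rule invariant_under_span_pairI, goal_cases)
  case (1 B C B' C')
  \<comment> \<open>With E = B^2 + C^2, u'' = -w^2 u and u'^2 = w^2 (E - u^2), the cubic terms have
    coefficients -1, -2 and 3 times b2 w^2 and cancel; \<open>k\<close> collects the factors of
    u.\<close>
  define k where "k = 2 * b2 * w\<^sup>2 * (B\<^sup>2 + C\<^sup>2) - b0 * w\<^sup>2 + c1"
  show ?case
    apply (rule exI[of _ "k * B + \<delta> * B'"])
    apply (rule exI[of _ "k * C + \<delta> * C'"])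
    apply (subst H1_eq[where u' = "\<lambda>x. w * (C * cos (w * x) - B * sin (w * x))"
          and u'' = "\<lambda>x. - (w\<^sup>2 * (B * cos (w * x) + C * sin (w * x)))"
          and D' = "\<lambda>v. 2 * b2 * v"])
    subgoal by (auto simp: algebra_simps intro!: derivative_eq_intros)
    subgoal by (auto simp: power2_eq_square algebra_simps intro!: derivative_eq_intros)
    subgoal by (auto intro!: derivative_eq_intros)
    subgoal unfolding trig_energy
      by (simp add: k_def fun_eq_iff power2_eq_square power3_eq_cube algebra_simps)
    done
qed

lemma invariant_const_trig:
  "invariant_under (fun_space.span {\<lambda>x. 1, \<lambda>x. cos (w * x), \<lambda>x. sin (w * x)})
    (H1 (\<lambda>v. b1 * v + b0) (\<lambda>v vbar. 2 * w\<^sup>2 * b1 * v\<^sup>2 + c1 * v + \<delta> * vbar + c0))"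
proof (rule invariant_under_span_tripleI, goal_cases)
  case (1 A B C A' B' C')
  \<comment> \<open>For u = A + v with v oscillating, the v^2 terms have coefficients -1, -1 and 2
    times b1 w^2. In \<open>k\<close>, the 3 is 4 from the square in the reaction minus 1 from D
    u''.\<close>
  define k where "k = 3 * w\<^sup>2 * b1 * A - b0 * w\<^sup>2 + c1"
  show ?case
    apply (rule exI[of _ "b1 * w\<^sup>2 * (B\<^sup>2 + C\<^sup>2) + 2 * w\<^sup>2 * b1 * A\<^sup>2 + c1 * A + \<delta> * A' + c0"])
    apply (rule exI[of _ "k * B + \<delta> * B'"])
    apply (rule exI[of _ "k * C + \<delta> * C'"])
    apply (subst H1_eq[where u' = "\<lambda>x. w * (C * cos (w * x) - B * sin (w * x))"
          and u'' = "\<lambda>x. - (w\<^sup>2 * (B * cos (w * x) + C * sin (w * x)))"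
          and D' = "\<lambda>v. b1"])
    subgoal by (auto simp: algebra_simps intro!: derivative_eq_intros)
    subgoal by (auto simp: power2_eq_square algebra_simps intro!: derivative_eq_intros)
    subgoal by (auto intro!: derivative_eq_intros)
    subgoal unfolding trig_energy
      by (simp add: k_def fun_eq_iff power2_eq_square algebra_simps)
    done
qed

theorem mainTheorem3:
  shows
    "(\<forall>(n::nat) (a0::real) (b::nat \<Rightarrow> real) (c::nat \<Rightarrow> real) (\<delta>::real).
        (\<forall>k\<in>{1..n}. c (k + 1) = - (real (k + 1) * a0\<^sup>2 * b k)) \<longrightarrow>
        invariant_under (fun_space.span {\<lambda>x. exp (- a0 * x)})
          (H1 (\<lambda>v. \<Sum>i=0..n. b i * v ^ i)
              (\<lambda>v vbar. (\<Sum>i=1..n + 1. c i * v ^ i) + \<delta> * vbar)))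
   \<and> (\<forall>(a1::real) (b0::real) (b1::real) (c0::real) (c1::real) (\<delta>::real).
        invariant_under (fun_space.span {\<lambda>x. 1, \<lambda>x. exp (- a1 * x)})
          (H1 (\<lambda>v. b1 * v + b0)
              (\<lambda>v vbar. - 2 * a1\<^sup>2 * b1 * v\<^sup>2 + c1 * v + \<delta> * vbar + c0)))
   \<and> (\<forall>(b0::real) (b1::real) (b2::real) (c0::real) (c1::real) (\<delta>::real).
        invariant_under (fun_space.span {\<lambda>x. 1, \<lambda>x. x})
          (H1 (\<lambda>v. b1 * v + b0)
              (\<lambda>v vbar. c1 * v + \<delta> * vbar + c0))
      \<and> invariant_under (fun_space.span {\<lambda>x. 1, \<lambda>x. x})
          (H1 (\<lambda>v. b2 * v\<^sup>2 + b1 * v + b0)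
              (\<lambda>v vbar. c1 * v + \<delta> * vbar + c0)))
   \<and> (\<forall>(b0::real) (b1::real) (c0::real) (c1::real) (\<delta>::real).
        invariant_under (fun_space.span {\<lambda>x. 1, \<lambda>x. x, \<lambda>x. x\<^sup>2})
          (H1 (\<lambda>v. b1 * v + b0)
              (\<lambda>v vbar. c1 * v + \<delta> * vbar + c0)))
   \<and> (\<forall>(a0::real) (b0::real) (b2::real) (c1::real) (\<delta>::real). a0 > 0 \<longrightarrow>
        invariant_under (fun_space.span {\<lambda>x. cos (sqrt a0 * x), \<lambda>x. sin (sqrt a0 * x)})
          (H1 (\<lambda>v. b2 * v\<^sup>2 + b0)
              (\<lambda>v vbar. 3 * a0 * b2 * v ^ 3 + c1 * v + \<delta> * vbar)))
   \<and> (\<forall>(a1::real) (b0::real) (b1::real) (c0::real) (c1::real) (\<delta>::real). a1 > 0 \<longrightarrow>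
        invariant_under
          (fun_space.span {\<lambda>x. 1, \<lambda>x. cos (sqrt a1 * x), \<lambda>x. sin (sqrt a1 * x)})
          (H1 (\<lambda>v. b1 * v + b0)
              (\<lambda>v vbar. 2 * a1 * b1 * v\<^sup>2 + c1 * v + \<delta> * vbar + c0)))"
proof (intro conjI allI impI, goal_cases)
  case 1
  then show ?case by (rule invariant_exp)
next
  case 2
  show ?case by (rule invariant_const_exp)
next
  case (3 b0 b1 b2 c0 c1 \<delta>)
  show ?case using invariant_affine[of 0 b1 b0 c1 \<delta> c0] by simp
next
  case 4
  show ?case by (rule invariant_affine)
next
  case 5
  show ?case by (rule invariant_quadratic)
next
  case (6 a0 b0 b2 c1 \<delta>)
  \<comment> \<open>Positivity of \<open>a0\<close> reduces the square of \<open>sqrt a0\<close> to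
    \<open>a0\<close>.\<close>
  then show ?case using invariant_trig[of "sqrt a0" b2 b0 c1 \<delta>] by simp
next
  case (7 a1 b0 b1 c0 c1 \<delta>)
  then show ?case using invariant_const_trig[of "sqrt a1" b1 b0 c1 \<delta> c0] by simp
qed

end
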